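(* Let $(X,d)$ be a complete semi-metric space satisfying the regular and normal properties for the basic triangle function. Let $q\ge 1$, $V=\{1,\dots,q\}$, and for $i,j\in V$ let $E_{i,j}$ be a finite set of directed edges from $i$ to $j$ such that for every $i\in V$ there exists $j\in V$ with $E_{i,j}\neq\emptyset$. For each $i,j \in V$ and each edge $e\in E_{i,j}$ let $\phi_e$ be a right-continuous comparison function and $f_e:X\to X$ a $\phi_e$-contraction. Define, for $\mathbf{H}=(H_1,\dots,H_q)\in\mathcal{P}(X)^q$, $$T(\mathbf{H})=\left(\bigcup_{j=1}^{q}\bigcup_{e\in E_{i,j}} f_e(H_j)\right)_{i=1}^{q}.$$ Then there exists a unique $\mathbf{H}\in\mathcal{K}(X)^q$ which is $T$-invariant. Furthermore, there exists $\mathbf{H}_0\in\mathcal{P}(X)^q$ such that $\mathbf{H}_0$ is a product of singletons of $X$ (that is, $\mathbf{H}_0=(\{z_1\},\dots,\{z_q\})$ with $z_1,\dots,z_q\in X$), $\mathbf{H}_0$ is $T$-subinvariant, and $\mathbf{H}=\overline{\bigcup_{n}T^n(\mathbf{H}_0)}$.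
   Context: Let $X$ be a non-empty set. A map $d:X^2\to[0,\infty)$ is a semi-metric if $d(x,y)=0$ if and only if $x=y$, and $d(x,y)=d(y,x)$ for all $x,y$ (no triangle inequality). Put $B(x,r)=\{y\in X: d(x,y)<r\}$. A subset $U\subset X$ is open if for every $x\in U$ there is $r>0$ with $B(x,r)\subset U$; this defines the topology on $X$ used for closedness, closure $\overline{H}$ and compactness (balls need not be open). A sequence $(x_n)_n$ is convergent if $\lim_n d(x_n,x)=0$ for some $x\in X$, and Cauchy if $\lim_{n,m\to\infty}d(x_n,x_m)=0$; $(X,d)$ is complete if every Cauchy sequence is convergent. The basic triangle function of $d$ is $\Phi_d(u,v)=\sup\{d(x,y): x,y\in X,\ \exists z\in X \text{ with } d(x,z)\le u,\ d(y,z)\le v\}\in[0,\infty]$ for $u,v\in[0,\infty)$. $(X,d)$ is regular (satisfies the regular property for the basic triangle function) if $\Phi_d$ is continuous at $(0,0)$, and normal (satisfies the normal property) if $\Phi_d(u,v)\neq\infty$ for all $u,v\in[0,\infty)$. A comparison function is a map $\phi:[0,\infty)\to[0,\infty)$ that is increasing (in the weak sense) with $\lim_{n\to\infty}\phi^n(t)=0$ for every $t>0$ ($\phi^n$ is the $n$-fold iterate). $f:X\to X$ is a $\phi$-contraction if $d(f(x),f(y))\le\phi(d(x,y))$ for all $x,y\in X$. $\mathcal{P}(X)$ is the set of non-empty subsets of $X$ and $\mathcal{K}(X)$ the set of non-empty compact subsets of $X$. For $\mathbf{A},\mathbf{B}\in\mathcal{P}(X)^q$, $\mathbf{A}\subset\mathbf{B}$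 means $A_i\subset B_i$ for all $i$. Unions of families of elements of $\mathcal{P}(X)^q$ and closures of elements of $\mathcal{P}(X)^q$ are taken componentwise. $\mathbf{H}$ is $T$-subinvariant if $\mathbf{H}\subset T(\mathbf{H})$ and $T$-invariant if $\mathbf{H}=T(\mathbf{H})$. $T^n$ is the $n$-fold iterate of $T$, $n\ge0$. Multiple edges and self-loops are allowed. *)

theory Defs
  imports "HOL-Analysis.Analysis"
begin

definition semimetric_space :: "'a set \<Rightarrow> ('a \<Rightarrow> 'a \<Rightarrow> real) \<Rightarrow> bool" where
  "semimetric_space X d \<longleftrightarrow>
     X \<noteq> {} \<and>
     (\<forall>x\<in>X. \<forall>y\<in>X. 0 \<le> d x y \<and> (d x y = 0 \<longleftrightarrow> x = y) \<and> d x y = d y x)"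

definition semimetric_ball :: "'a set \<Rightarrow> ('a \<Rightarrow> 'a \<Rightarrow> real) \<Rightarrow> 'a \<Rightarrow> real \<Rightarrow> 'a set" where
  "semimetric_ball X d x r = {y \<in> X. d x y < r}"

text \<open>Without the triangle inequality a ball need not be open in this topology.\<close>

definition semimetric_topology :: "'a set \<Rightarrow> ('a \<Rightarrow> 'a \<Rightarrow> real) \<Rightarrow> 'a topology" where
  "semimetric_topology X d =
     topology (\<lambda>U. U \<subseteq> X \<and> (\<forall>x\<in>U. \<exists>r>0. semimetric_ball X d x r \<subseteq> U))"

lemma openin_semimetric_topology:
  "openin (semimetric_topology X d) U \<longleftrightarrow>
     U \<subseteq> X \<and> (\<forall>x\<in>U. \<exists>r>0. semimetric_ball X d x r \<subseteq> U)"
proof -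
  let ?L = "\<lambda>U. U \<subseteq> X \<and> (\<forall>x\<in>U. \<exists>r>0. semimetric_ball X d x r \<subseteq> U)"
  have "?L (S \<inter> T)" if S: "?L S" and T: "?L T" for S T
  proof (intro conjI ballI)
    show "S \<inter> T \<subseteq> X" using S by blast
    fix x assume "x \<in> S \<inter> T"
    then obtain r s where "r > 0" "semimetric_ball X d x r \<subseteq> S"
      "s > 0" "semimetric_ball X d x s \<subseteq> T"
      using S T by blast
    then show "\<exists>r>0. semimetric_ball X d x r \<subseteq> S \<inter> T"
      by (intro exI[of _ "min r s"]) (auto simp: semimetric_ball_def)
  qed
  moreover have "?L (\<Union>\<K>)" if "\<forall>K\<in>\<K>. ?L K" for \<K>
    using that by (meson Sup_least Sup_upper UnionE order_trans)
  ultimately have "istopology ?L"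
    unfolding istopology_def by blast
  then show ?thesis
    by (simp add: semimetric_topology_def topology_inverse')
qed

lemma topspace_semimetric_topology [simp]: "topspace (semimetric_topology X d) = X"
proof
  show "topspace (semimetric_topology X d) \<subseteq> X"
    unfolding topspace_def openin_semimetric_topology by blast
  have "openin (semimetric_topology X d) X"
    unfolding openin_semimetric_topology semimetric_ball_def
    by (auto intro: exI[of _ 1])
  then show "X \<subseteq> topspace (semimetric_topology X d)"
    by (rule openin_subset)
qed

definition semimetric_convergent :: "'a set \<Rightarrow> ('a \<Rightarrow> 'a \<Rightarrow> real) \<Rightarrow> (nat \<Rightarrow> 'a) \<Rightarrow> bool" where
  "semimetric_convergent X d \<sigma> \<longleftrightarrow> (\<exists>x\<in>X. (\<lambda>n. d (\<sigma> n) x) \<longlonglongrightarrow> 0)"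

definition semimetric_Cauchy :: "('a \<Rightarrow> 'a \<Rightarrow> real) \<Rightarrow> (nat \<Rightarrow> 'a) \<Rightarrow> bool" where
  "semimetric_Cauchy d \<sigma> \<longleftrightarrow>
     ((\<lambda>(n, m). d (\<sigma> n) (\<sigma> m)) \<longlongrightarrow> 0) (sequentially \<times>\<^sub>F sequentially)"

definition semimetric_complete :: "'a set \<Rightarrow> ('a \<Rightarrow> 'a \<Rightarrow> real) \<Rightarrow> bool" where
  "semimetric_complete X d \<longleftrightarrow>
     (\<forall>\<sigma>. range \<sigma> \<subseteq> X \<and> semimetric_Cauchy d \<sigma> \<longrightarrow> semimetric_convergent X d \<sigma>)"

definition basic_triangle_function ::
  "'a set \<Rightarrow> ('a \<Rightarrow> 'a \<Rightarrow> real) \<Rightarrow> real \<Rightarrow> real \<Rightarrow> ennreal" where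
  "basic_triangle_function X d u v =
     Sup {ennreal (d x y) |x y. x \<in> X \<and> y \<in> X \<and> (\<exists>z\<in>X. d x z \<le> u \<and> d y z \<le> v)}"

definition regular_semimetric :: "'a set \<Rightarrow> ('a \<Rightarrow> 'a \<Rightarrow> real) \<Rightarrow> bool" where
  "regular_semimetric X d \<longleftrightarrow>
     continuous (at (0, 0) within {0..} \<times> {0..}) (\<lambda>(u, v). basic_triangle_function X d u v)"

definition normal_semimetric :: "'a set \<Rightarrow> ('a \<Rightarrow> 'a \<Rightarrow> real) \<Rightarrow> bool" where
  "normal_semimetric X d \<longleftrightarrow>
     (\<forall>u\<ge>0. \<forall>v\<ge>0. basic_triangle_function X d u v \<noteq> \<infinity>)"

text \<open>A map from the half-line to itself is a function on the reals of which
  only the values on \<open>{0..}\<close> matter.\<close>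

definition comparison_function :: "(real \<Rightarrow> real) \<Rightarrow> bool" where
  "comparison_function \<phi> \<longleftrightarrow>
     \<phi> \<in> {0..} \<rightarrow> {0..} \<and> mono_on {0..} \<phi> \<and> (\<forall>t>0. (\<lambda>n. (\<phi> ^^ n) t) \<longlonglongrightarrow> 0)"

definition right_continuous :: "(real \<Rightarrow> real) \<Rightarrow> bool" where
  "right_continuous \<phi> \<longleftrightarrow> (\<forall>t\<ge>0. continuous (at_right t) \<phi>)"

definition phi_contraction ::
  "'a set \<Rightarrow> ('a \<Rightarrow> 'a \<Rightarrow> real) \<Rightarrow> (real \<Rightarrow> real) \<Rightarrow> ('a \<Rightarrow> 'a) \<Rightarrow> bool" where
  "phi_contraction X d \<phi> f \<longleftrightarrow>
     f \<in> X \<rightarrow> X \<and> (\<forall>x\<in>X. \<forall>y\<in>X. d (f x) (f y) \<le> \<phi> (d x y))"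

definition nonempty_subsets :: "'a set \<Rightarrow> 'a set set" where
  "nonempty_subsets X = {A. A \<subseteq> X \<and> A \<noteq> {}}"

definition nonempty_compacts :: "'a set \<Rightarrow> ('a \<Rightarrow> 'a \<Rightarrow> real) \<Rightarrow> 'a set set" where
  "nonempty_compacts X d = {K. compactin (semimetric_topology X d) K \<and> K \<noteq> {}}"

text \<open>A \<open>q\<close>-tuple with entries in \<open>S\<close> is an element of \<open>{1..q} \<rightarrow>\<^sub>E S\<close>; extensionality
  (a fixed value outside \<open>{1..q}\<close>) makes equality of tuples componentwise equality.\<close>

definition tuple_subset :: "nat \<Rightarrow> (nat \<Rightarrow> 'a set) \<Rightarrow> (nat \<Rightarrow> 'a set) \<Rightarrow> bool" where
  "tuple_subset q A B \<longleftrightarrow> (\<forall>i\<in>{1..q}. A i \<subseteq> B i)"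

definition tuple_Union :: "nat \<Rightarrow> (nat \<Rightarrow> nat \<Rightarrow> 'a set) \<Rightarrow> nat \<Rightarrow> 'a set" where
  "tuple_Union q F = (\<lambda>i\<in>{1..q}. \<Union>n. F n i)"

definition tuple_closure ::
  "'a set \<Rightarrow> ('a \<Rightarrow> 'a \<Rightarrow> real) \<Rightarrow> nat \<Rightarrow> (nat \<Rightarrow> 'a set) \<Rightarrow> nat \<Rightarrow> 'a set" where
  "tuple_closure X d q A = (\<lambda>i\<in>{1..q}. semimetric_topology X d closure_of A i)"

definition graph_operator ::
  "nat \<Rightarrow> (nat \<Rightarrow> nat \<Rightarrow> 'e set) \<Rightarrow> ('e \<Rightarrow> 'a \<Rightarrow> 'a) \<Rightarrow> (nat \<Rightarrow> 'a set) \<Rightarrow> nat \<Rightarrow> 'a set" where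
  "graph_operator q E f H = (\<lambda>i\<in>{1..q}. \<Union>j\<in>{1..q}. \<Union>e\<in>E i j. f e ` H j)"

definition invariant :: "((nat \<Rightarrow> 'a set) \<Rightarrow> nat \<Rightarrow> 'a set) \<Rightarrow> (nat \<Rightarrow> 'a set) \<Rightarrow> bool" where
  "invariant T H \<longleftrightarrow> H = T H"

definition subinvariant ::
  "nat \<Rightarrow> ((nat \<Rightarrow> 'a set) \<Rightarrow> nat \<Rightarrow> 'a set) \<Rightarrow> (nat \<Rightarrow> 'a set) \<Rightarrow> bool" where
  "subinvariant q T H \<longleftrightarrow> tuple_subset q H (T H)"

end

theory Submission
  imports Defs
begin

text \<open>
  Regularity of \<open>d\<close> is a uniform substitute for the triangle inequality: for every
  \<open>\<epsilon> > 0\<close> there is \<open>\<delta> > 0\<close> such that points at distance at most \<open>\<delta>\<close> from a common point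
  are at distance less than \<open>\<epsilon>\<close>. Hence balls are neighbourhoods, the topology
  is Hausdorff, and in a complete space the closure of a totally bounded set is compact. The
  pointwise maximum \<open>\<psi>\<close> of the finitely many comparison functions is again a comparison
  function, so all edge maps contract with the same \<open>\<psi>\<close>. If each point
  of \<open>A\<close> is within \<open>r\<close> of a point of the tuple \<open>B\<close> (componentwise), then each point of
  \<open>T(A)\<close> is within \<open>\<psi>(r)\<close> of a point of \<open>T(B)\<close>.

  The central fact (\<open>orbit_near\<close>) is that for a tuple \<open>A\<close> of singletons and
  \<open>\<epsilon> > 0\<close> there is \<open>n\<close> such that \<open>T\<^sup>m(A)\<close> lies in the \<open>\<epsilon>\<close>-neighbourhood of
  \<open>T\<^sup>n(A)\<close> for all \<open>m \<ge> n\<close>. As the triangle inequality cannot be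
  summed, this is shown by choosing \<open>N\<close> so large that \<open>T\<^sup>N\<close> maps tuples close to
  \<open>T\<^sup>n(A)\<close> to tuples close to \<open>T\<^sup>n(A)\<close>. It is used twice.
  Selecting one edge out of every vertex yields a subgraph under whose operator singletons
  stay singletons. There the fact says that the orbit is a Cauchy sequence of points, and
  the limits \<open>z\<^sub>i\<close> give the subinvariant tuple \<open>H\<^sub>0\<close>. For the full graph it says that
  \<open>\<Union>\<^sub>n T\<^sup>n(H\<^sub>0)\<close> is totally bounded, since every \<open>T\<^sup>n(H\<^sub>0)\<close> has finite components.
  The closure of this union is compact, and it is invariant because the edge maps are
  continuous and compact sets are closed.

  For uniqueness, compact sets are bounded and normality bounds the distances between points
  of two invariant tuples \<open>H\<close> and \<open>K\<close> by some \<open>c\<close>. Then \<open>H = T\<^sup>n(H)\<close> lies in the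
  \<open>\<psi>\<^sup>n(c)\<close>-neighbourhood of \<open>K = T\<^sup>n(K)\<close> for every \<open>n\<close>, so \<open>H\<close> is contained in the
  closed tuple \<open>K\<close>, and conversely.
\<close>

section \<open>Regular semi-metric spaces\<close>

locale regular_semimetric_space =
  fixes X :: "'a set" and d :: "'a \<Rightarrow> 'a \<Rightarrow> real"
  assumes semimetric: "semimetric_space X d"
    and regular: "regular_semimetric X d"
begin

abbreviation \<tau> :: "'a topology" where
  "\<tau> \<equiv> semimetric_topology X d"

lemma d_nonneg: "x \<in> X \<Longrightarrow> y \<in> X \<Longrightarrow> 0 \<le> d x y"
  and d_eq_0: "x \<in> X \<Longrightarrow> y \<in> X \<Longrightarrow> d x y = 0 \<longleftrightarrow> x = y"
  and d_sym: "x \<in> X \<Longrightarrow> y \<in> X \<Longrightarrow> d x y = d y x"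
  using semimetric unfolding semimetric_space_def by auto

lemma d_self: "x \<in> X \<Longrightarrow> d x x = 0"
  by (simp add: d_eq_0)

lemma dist_le_basic_triangle_function:
  assumes "x \<in> X" "y \<in> X" "z \<in> X" "d x z \<le> u" "d z y \<le> v"
  shows "ennreal (d x y) \<le> basic_triangle_function X d u v"
  unfolding basic_triangle_function_def
  using assms d_sym[of z y] by (intro Sup_upper) auto

lemma basic_triangle_function_0: "basic_triangle_function X d 0 0 = 0"
proof -
  have "ennreal (d x y) \<le> 0" if "x \<in> X" "y \<in> X" "z \<in> X" "d x z \<le> 0" "d y z \<le> 0" for x y z
  proof -
    have "d x z = 0" "d y z = 0"
      using that d_nonneg[of x z] d_nonneg[of y z] by linarith+
    then have "x = z" "y = z"
      using that d_eq_0[of x z] d_eq_0[of y z] by simp_all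
    then show ?thesis using d_self[OF that(3)] by simp
  qed
  then have "basic_triangle_function X d 0 0 \<le> 0"
    unfolding basic_triangle_function_def by (intro Sup_least) blast
  then show ?thesis by simp
qed

text \<open>The only consequence of regularity that is used: \<open>\<Phi>\<^sub>d(\<delta>, \<delta>) < \<epsilon>\<close> for a suitable
  \<open>\<delta>\<close>, spelled out in terms of distances.\<close>

lemma weak_triangle:
  assumes "0 < \<epsilon>"
  obtains \<delta> where "0 < \<delta>"
    "\<And>x y z. \<lbrakk>x \<in> X; y \<in> X; z \<in> X; d x z \<le> \<delta>; d z y \<le> \<delta>\<rbrakk> \<Longrightarrow> d x y < \<epsilon>"
proof -
  let ?S = "{0..} \<times> {0..} :: (real \<times> real) set"
  have "((\<lambda>(u, v). basic_triangle_function X d u v) \<longlongrightarrow> 0) (at (0, 0) within ?S)"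
    using regular unfolding regular_semimetric_def continuous_within
    by (simp add: basic_triangle_function_0)
  then have "\<forall>\<^sub>F p in at (0, 0) within ?S.
      (case p of (u, v) \<Rightarrow> basic_triangle_function X d u v) < ennreal \<epsilon>"
    using assms by (intro order_tendstoD) auto
  then obtain \<eta> where \<eta>: "0 < \<eta>"
    "\<And>p. \<lbrakk>p \<in> ?S; p \<noteq> (0, 0); dist p (0, 0) < \<eta>\<rbrakk> \<Longrightarrow>
       (case p of (u, v) \<Rightarrow> basic_triangle_function X d u v) < ennreal \<epsilon>"
    unfolding eventually_at by blast
  have "norm (\<eta> / 3, \<eta> / 3) \<le> norm (\<eta> / 3) + norm (\<eta> / 3)"
    by (rule norm_Pair_le)
  then have "dist (\<eta> / 3, \<eta> / 3) (0, 0) < \<eta>"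
    using \<eta>(1) by (simp add: dist_norm flip: zero_prod_def)
  then have small: "basic_triangle_function X d (\<eta> / 3) (\<eta> / 3) < ennreal \<epsilon>"
    using \<eta>(1) \<eta>(2)[of "(\<eta> / 3, \<eta> / 3)"] by simp
  show thesis
  proof (rule that[of "\<eta> / 3"])
    fix x y z
    assume "x \<in> X" "y \<in> X" "z \<in> X" "d x z \<le> \<eta> / 3" "d z y \<le> \<eta> / 3"
    from dist_le_basic_triangle_function[OF this] small
    have "ennreal (d x y) < ennreal \<epsilon>" by (rule le_less_trans)
    then show "d x y < \<epsilon>"
      using \<open>x \<in> X\<close> \<open>y \<in> X\<close> by (simp add: ennreal_less_iff d_nonneg)
  qed (use \<eta>(1) in simp)
qed

text \<open>Balls need not be open; \<open>U\<close> consists of the points of the ball that have a whole ball around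
  them inside it, and regularity makes this set open.\<close>

lemma ball_neighbourhood:
  assumes "x \<in> X" "0 < r"
  obtains U where "openin \<tau> U" "x \<in> U" "\<And>y. y \<in> U \<Longrightarrow> y \<in> X \<and> d x y < r"
proof
  let ?B = "semimetric_ball X d x r"
  let ?U = "{y \<in> ?B. \<exists>s>0. semimetric_ball X d y s \<subseteq> ?B}"
  show "openin \<tau> ?U"
    unfolding openin_semimetric_topology
  proof (intro conjI ballI)
    fix y assume "y \<in> ?U"
    then obtain s where y: "y \<in> X" and s: "0 < s" "semimetric_ball X d y s \<subseteq> ?B"
      by (auto simp: semimetric_ball_def)
    obtain \<delta> where \<delta>: "0 < \<delta>"
      "\<And>a b c. \<lbrakk>a \<in> X; b \<in> X; c \<in> X; d a c \<le> \<delta>; d c b \<le> \<delta>\<rbrakk> \<Longrightarrow> d a b < s"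
      using weak_triangle[OF s(1)] by blast
    have "semimetric_ball X d z \<delta> \<subseteq> semimetric_ball X d y s"
      if "z \<in> semimetric_ball X d y \<delta>" for z
      using that y \<delta>(2)[of y _ z] by (fastforce simp: semimetric_ball_def)
    moreover have "z \<in> semimetric_ball X d z \<delta>" if "z \<in> X" for z
      using that \<delta>(1) by (simp add: semimetric_ball_def d_self)
    ultimately have "semimetric_ball X d y \<delta> \<subseteq> ?U"
      using s(2) \<delta>(1) by (fastforce simp: semimetric_ball_def)
    with \<delta>(1) show "\<exists>r>0. semimetric_ball X d y r \<subseteq> ?U" by blast
  qed (auto simp: semimetric_ball_def)
  show "x \<in> ?U"
    using assms by (auto simp: semimetric_ball_def d_self)
qed (auto simp: semimetric_ball_def)

lemma Hausdorff_semimetric_topology: "Hausdorff_space \<tau>"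
  unfolding Hausdorff_space_def topspace_semimetric_topology
proof (intro allI impI, elim conjE)
  fix x y assume xy: "x \<in> X" "y \<in> X" "x \<noteq> y"
  then have "0 < d x y"
    using d_nonneg[of x y] d_eq_0[of x y] by linarith
  then obtain \<delta> where \<delta>: "0 < \<delta>"
    "\<And>a b c. \<lbrakk>a \<in> X; b \<in> X; c \<in> X; d a c \<le> \<delta>; d c b \<le> \<delta>\<rbrakk> \<Longrightarrow> d a b < d x y"
    using weak_triangle by blast
  obtain U where U: "openin \<tau> U" "x \<in> U" "\<And>z. z \<in> U \<Longrightarrow> z \<in> X \<and> d x z < \<delta>"
    using ball_neighbourhood[OF xy(1) \<delta>(1)] by blast
  obtain V where V: "openin \<tau> V" "y \<in> V" "\<And>z. z \<in> V \<Longrightarrow> z \<in> X \<and> d y z < \<delta>"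
    using ball_neighbourhood[OF xy(2) \<delta>(1)] by blast
  have "disjnt U V"
  proof (rule ccontr)
    assume "\<not> disjnt U V"
    then obtain z where z: "z \<in> U" "z \<in> V" by (auto simp: disjnt_def)
    then have "d x y < d x y"
      using \<delta>(2)[of x y z] U(3)[of z] V(3)[of z] xy d_sym[of y z] by fastforce
    then show False by simp
  qed
  with U V show "\<exists>U V. openin \<tau> U \<and> openin \<tau> V \<and> x \<in> U \<and> y \<in> V \<and> disjnt U V"
    by blast
qed

lemma in_closure_of_semimetric:
  assumes "A \<subseteq> X"
  shows "x \<in> \<tau> closure_of A \<longleftrightarrow> x \<in> X \<and> (\<forall>r>0. \<exists>a\<in>A. d x a < r)"
proof (intro iffI conjI allI impI)
  assume x: "x \<in> \<tau> closure_of A"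
  then show "x \<in> X"
    using closure_of_subset_topspace[of \<tau> A] by auto
  fix r :: real assume "0 < r"
  then obtain U where U: "openin \<tau> U" "x \<in> U" "\<And>y. y \<in> U \<Longrightarrow> y \<in> X \<and> d x y < r"
    using ball_neighbourhood[OF \<open>x \<in> X\<close>] by blast
  with x obtain a where "a \<in> A" "a \<in> U" by (auto simp: in_closure_of)
  with U(3) show "\<exists>a\<in>A. d x a < r" by blast
next
  assume R: "x \<in> X \<and> (\<forall>r>0. \<exists>a\<in>A. d x a < r)"
  show "x \<in> \<tau> closure_of A"
    unfolding in_closure_of topspace_semimetric_topology
  proof (intro conjI allI impI)
    fix U assume "x \<in> U \<and> openin \<tau> U"
    then obtain r where r: "0 < r" "semimetric_ball X d x r \<subseteq> U"
      by (auto simp: openin_semimetric_topology)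
    with R obtain a where "a \<in> A" "d x a < r" by blast
    with r assms show "\<exists>y. y \<in> A \<and> y \<in> U"
      by (auto simp: semimetric_ball_def)
  qed (use R in simp)
qed

lemma limit_unique:
  assumes "x \<in> X" "y \<in> X" "range s \<subseteq> X"
    and "(\<lambda>n. d (s n) x) \<longlonglongrightarrow> 0" "(\<lambda>n. d (s n) y) \<longlonglongrightarrow> 0"
  shows "x = y"
proof (rule ccontr)
  assume "x \<noteq> y"
  then have "0 < d x y"
    using assms(1,2) d_nonneg[of x y] d_eq_0[of x y] by linarith
  then obtain \<delta> where \<delta>: "0 < \<delta>"
    "\<And>a b c. \<lbrakk>a \<in> X; b \<in> X; c \<in> X; d a c \<le> \<delta>; d c b \<le> \<delta>\<rbrakk> \<Longrightarrow> d a b < d x y"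
    using weak_triangle by blast
  have "\<forall>\<^sub>F n in sequentially. d (s n) x < \<delta> \<and> d (s n) y < \<delta>"
    using assms(4,5) \<delta>(1) by (intro eventually_conj order_tendstoD)
  then obtain n where n: "d (s n) x < \<delta>" "d (s n) y < \<delta>"
    by (auto dest: eventually_happens)
  have "s n \<in> X" using assms(3) by auto
  then have "d x y < d x y"
    using n \<delta>(2)[of x y "s n"] assms(1,2) d_sym[of "s n" x] by simp
  then show False by simp
qed

lemma Cauchy_if_eventually_near:
  assumes s: "range s \<subseteq> X"
    and near: "\<And>\<epsilon>. 0 < \<epsilon> \<Longrightarrow> \<exists>c\<in>X. \<exists>n. \<forall>m\<ge>n. d (s m) c \<le> \<epsilon>"
  shows "semimetric_Cauchy d s"
  unfolding semimetric_Cauchy_def tendsto_iff eventually_prod_sequentially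
proof (intro allI impI)
  fix \<epsilon> :: real assume "0 < \<epsilon>"
  then obtain \<delta> where \<delta>: "0 < \<delta>"
    "\<And>a b c. \<lbrakk>a \<in> X; b \<in> X; c \<in> X; d a c \<le> \<delta>; d c b \<le> \<delta>\<rbrakk> \<Longrightarrow> d a b < \<epsilon>"
    using weak_triangle by blast
  obtain c n where c: "c \<in> X" "\<And>m. n \<le> m \<Longrightarrow> d (s m) c \<le> \<delta>"
    using near[OF \<delta>(1)] by blast
  have sX: "s m \<in> X" for m using s by auto
  have "d (s k) (s m) < \<epsilon>" if "n \<le> k" "n \<le> m" for k m
    using \<delta>(2)[of "s k" "s m" c] c(1) c(2)[OF that(1)] c(2)[OF that(2)] sX d_sym[of "s m" c]
    by simp
  then show "\<exists>N. \<forall>m\<ge>N. \<forall>k\<ge>N. dist (case (k, m) of (n, m) \<Rightarrow> d (s n) (s m)) 0 < \<epsilon>"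
    using d_nonneg sX by (intro exI[of _ n]) simp
qed

text \<open>A set that no finite part of the cover contains is cut repeatedly into finitely many smaller
  pieces, one of which inherits this defect. In the limit the nested pieces shrink to a point,
  and a single open set around it contains one of them.\<close>

lemma compactin_closure_of_totally_bounded:
  assumes complete: "semimetric_complete X d"
    and A: "A \<subseteq> X"
    and tb: "\<And>\<epsilon>. 0 < \<epsilon> \<Longrightarrow> \<exists>F. finite F \<and> F \<subseteq> X \<and> (\<forall>a\<in>A. \<exists>c\<in>F. d a c \<le> \<epsilon>)"
  shows "compactin \<tau> (\<tau> closure_of A)"
  unfolding compactin_def topspace_semimetric_topology
proof (intro conjI allI impI)
  let ?K = "\<tau> closure_of A"
  show KX: "?K \<subseteq> X"
    using closure_of_subset_topspace[of \<tau> A] by simp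
  have net: "\<exists>F. finite F \<and> F \<subseteq> X \<and> (\<forall>a\<in>?K. \<exists>c\<in>F. d a c \<le> \<epsilon>)" if "0 < \<epsilon>" for \<epsilon>
  proof -
    obtain \<delta> where \<delta>: "0 < \<delta>"
      "\<And>a b c. \<lbrakk>a \<in> X; b \<in> X; c \<in> X; d a c \<le> \<delta>; d c b \<le> \<delta>\<rbrakk> \<Longrightarrow> d a b < \<epsilon>"
      using weak_triangle[OF \<open>0 < \<epsilon>\<close>] by blast
    obtain F where F: "finite F" "F \<subseteq> X" "\<And>a. a \<in> A \<Longrightarrow> \<exists>c\<in>F. d a c \<le> \<delta>"
      using tb[OF \<delta>(1)] by blast
    have "\<exists>c\<in>F. d x c \<le> \<epsilon>" if x: "x \<in> ?K" for x
    proof -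
      obtain a where a: "a \<in> A" "d x a < \<delta>"
        using x \<delta>(1) by (auto simp: in_closure_of_semimetric[OF A])
      with F(3) obtain c where c: "c \<in> F" "d a c \<le> \<delta>" by blast
      have "d x c < \<epsilon>"
        using a c x KX A F(2) by (intro \<delta>(2)[of x c a]) auto
      with c(1) show ?thesis by force
    qed
    with F show ?thesis by blast
  qed
  fix \<U> assume cover: "Ball \<U> (openin \<tau>) \<and> ?K \<subseteq> \<Union>\<U>"
  define bad where "bad C \<longleftrightarrow> \<not> (\<exists>\<F>. finite \<F> \<and> \<F> \<subseteq> \<U> \<and> C \<subseteq> \<Union>\<F>)" for C
  show "\<exists>\<F>. finite \<F> \<and> \<F> \<subseteq> \<U> \<and> ?K \<subseteq> \<Union>\<F>"
  proof (rule ccontr)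
    assume "\<not> ?thesis"
    then have bad_K: "bad ?K" by (simp add: bad_def)
    have bad_piece: "\<exists>c\<in>X. bad {y \<in> C. d y c \<le> \<epsilon>}" if "bad C" "C \<subseteq> ?K" "0 < \<epsilon>" for C \<epsilon>
    proof (rule ccontr)
      assume no: "\<not> ?thesis"
      obtain F where F: "finite F" "F \<subseteq> X" "\<And>a. a \<in> ?K \<Longrightarrow> \<exists>c\<in>F. d a c \<le> \<epsilon>"
        using net[OF \<open>0 < \<epsilon>\<close>] by blast
      have "\<forall>c\<in>F. \<not> bad {y \<in> C. d y c \<le> \<epsilon>}"
        using no F(2) by blast
      then have "\<forall>c\<in>F. \<exists>\<F>. finite \<F> \<and> \<F> \<subseteq> \<U> \<and> {y \<in> C. d y c \<le> \<epsilon>} \<subseteq> \<Union>\<F>"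
        unfolding bad_def not_not .
      then obtain \<F> where \<F>: "\<forall>c\<in>F. finite (\<F> c) \<and> \<F> c \<subseteq> \<U> \<and> {y \<in> C. d y c \<le> \<epsilon>} \<subseteq> \<Union>(\<F> c)"
        by metis
      have "C \<subseteq> \<Union>(\<Union>c\<in>F. \<F> c)"
      proof
        fix y assume "y \<in> C"
        then have "y \<in> ?K" using \<open>C \<subseteq> ?K\<close> by (rule subsetD[rotated])
        then obtain c where c: "c \<in> F" "d y c \<le> \<epsilon>" using F(3) by metis
        have "{y \<in> C. d y c \<le> \<epsilon>} \<subseteq> \<Union>(\<F> c)" using \<F> c(1) by simp
        then have "y \<in> \<Union>(\<F> c)" using \<open>y \<in> C\<close> c(2) by blast
        then show "y \<in> \<Union>(\<Union>c\<in>F. \<F> c)" using c(1) by blast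
      qed
      moreover have "finite (\<Union>c\<in>F. \<F> c)" using \<F> F(1) by simp
      moreover have "(\<Union>c\<in>F. \<F> c) \<subseteq> \<U>" using \<F> by (simp add: UN_least)
      ultimately show False using \<open>bad C\<close> unfolding bad_def by metis
    qed
    have "\<exists>C. \<forall>n. (bad (C n) \<and> C n \<subseteq> ?K) \<and>
        (C (Suc n) \<subseteq> C n \<and> (\<exists>c\<in>X. \<forall>y\<in>C (Suc n). d y c \<le> inverse (real (Suc n))))"
    proof (rule dependent_nat_choice)
      fix C :: "'a set" and n :: nat
      assume C: "bad C \<and> C \<subseteq> ?K"
      obtain c where c: "c \<in> X" "bad {y \<in> C. d y c \<le> inverse (real (Suc n))}"
        using bad_piece[of C "inverse (real (Suc n))"] C by auto
      moreover have "{y \<in> C. d y c \<le> inverse (real (Suc n))} \<subseteq> C" by (rule Collect_subset)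
      ultimately show "\<exists>C'. (bad C' \<and> C' \<subseteq> ?K) \<and>
          (C' \<subseteq> C \<and> (\<exists>c\<in>X. \<forall>y\<in>C'. d y c \<le> inverse (real (Suc n))))"
        using C by (intro exI[of _ "{y \<in> C. d y c \<le> inverse (real (Suc n))}"]) blast
    qed (use bad_K in blast)
    then obtain C where C: "\<And>n. bad (C n)" "\<And>n. C n \<subseteq> ?K" "\<And>n. C (Suc n) \<subseteq> C n"
      "\<And>n. \<exists>c\<in>X. \<forall>y\<in>C (Suc n). d y c \<le> inverse (real (Suc n))"
      by blast
    have C_anti: "C m \<subseteq> C n" if "n \<le> m" for n m
      using lift_Suc_antimono_le[of C, OF C(3) that] .
    have C_small: "\<exists>c\<in>X. \<exists>n. \<forall>y\<in>C n. d y c \<le> \<epsilon>" if \<epsilon>: "0 < \<epsilon>" for \<epsilon>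
    proof -
      obtain n where n: "inverse (real (Suc n)) < \<epsilon>"
        using reals_Archimedean[OF \<epsilon>] by auto
      obtain c where "c \<in> X" "\<forall>y\<in>C (Suc n). d y c \<le> inverse (real (Suc n))"
        using C(4)[of n] by blast
      with n show ?thesis by (intro bexI[of _ c] exI[of _ "Suc n"]) fastforce+
    qed
    have "C n \<noteq> {}" for n
      using C(1)[of n] unfolding bad_def by (metis empty_subsetI finite.emptyI)
    then have "\<exists>s. \<forall>n. s n \<in> C n"
      by (intro choice) blast
    then obtain s where s: "\<And>n. s n \<in> C n" by blast
    have sX: "range s \<subseteq> X" using s C(2) KX by blast
    have "semimetric_Cauchy d s"
    proof (rule Cauchy_if_eventually_near[OF sX])
      fix \<epsilon> :: real assume "0 < \<epsilon>"
      then obtain c n where "c \<in> X" "\<forall>y\<in>C n. d y c \<le> \<epsilon>" using C_small by blast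
      then show "\<exists>c\<in>X. \<exists>n. \<forall>m\<ge>n. d (s m) c \<le> \<epsilon>" using s C_anti by blast
    qed
    then obtain x where x: "x \<in> X" "(\<lambda>n. d (s n) x) \<longlonglongrightarrow> 0"
      using complete sX unfolding semimetric_complete_def semimetric_convergent_def by blast
    have ev: "\<exists>m\<ge>n. d x (s m) < r" if "0 < r" for n r
    proof -
      have "\<forall>\<^sub>F m in sequentially. d (s m) x < r"
        using order_tendstoD(2)[OF x(2) that] .
      then obtain N where "\<And>m. N \<le> m \<Longrightarrow> d (s m) x < r"
        unfolding eventually_sequentially by blast
      then have "d (s (max n N)) x < r" by simp
      moreover have "s (max n N) \<in> X" using sX by blast
      ultimately show ?thesis
        using d_sym[OF x(1)] by (intro exI[of _ "max n N"]) simp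
    qed
    have "x \<in> \<tau> closure_of ?K"
      unfolding in_closure_of_semimetric[OF KX]
    proof (intro conjI allI impI)
      fix r :: real assume "0 < r"
      then obtain m where "d x (s m) < r" using ev[of r 0] by blast
      moreover have "s m \<in> ?K" using s C(2) by (rule subsetD[rotated])
      ultimately show "\<exists>a\<in>?K. d x a < r" by blast
    qed (rule x(1))
    then have "x \<in> ?K" by simp
    with cover obtain U where U: "U \<in> \<U>" "x \<in> U" "openin \<tau> U" by auto
    then obtain r where r: "0 < r" "semimetric_ball X d x r \<subseteq> U"
      by (auto simp: openin_semimetric_topology)
    obtain \<delta> where \<delta>: "0 < \<delta>"
      "\<And>a b c. \<lbrakk>a \<in> X; b \<in> X; c \<in> X; d a c \<le> \<delta>; d c b \<le> \<delta>\<rbrakk> \<Longrightarrow> d a b < r"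
      using weak_triangle[OF r(1)] by blast
    obtain \<eta> where \<eta>: "0 < \<eta>"
      "\<And>a b c. \<lbrakk>a \<in> X; b \<in> X; c \<in> X; d a c \<le> \<eta>; d c b \<le> \<eta>\<rbrakk> \<Longrightarrow> d a b < \<delta>"
      using weak_triangle[OF \<delta>(1)] by blast
    obtain c n where c: "c \<in> X" "\<forall>y\<in>C n. d y c \<le> \<eta>" using C_small[OF \<eta>(1)] by blast
    obtain m where m: "d x (s m) < \<delta>" "n \<le> m" using ev[OF \<delta>(1)] by blast
    have sm: "s m \<in> C n" using s C_anti[OF m(2)] by blast
    have "C n \<subseteq> U"
    proof
      fix y assume y: "y \<in> C n"
      have X: "y \<in> X" "s m \<in> X" using y sm C(2) KX by blast+
      have "d (s m) y < \<delta>"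
        using \<eta>(2)[of "s m" y c] c(1) bspec[OF c(2) y] bspec[OF c(2) sm] X d_sym[of y c]
        by simp
      then have "d x y < r"
        using \<delta>(2)[of x y "s m"] m X x(1) by simp
      with r(2) X(1) show "y \<in> U" by (auto simp: semimetric_ball_def)
    qed
    then show False
      using C(1)[of n] U(1) unfolding bad_def by (auto dest: spec[of _ "{U}"])
  qed
qed

lemma normal_bound:
  assumes normal: "normal_semimetric X d" and "0 \<le> u" "0 \<le> v"
  obtains c where "0 < c"
    "\<And>x y z. \<lbrakk>x \<in> X; y \<in> X; z \<in> X; d x z \<le> u; d z y \<le> v\<rbrakk> \<Longrightarrow> d x y \<le> c"
proof
  let ?\<Phi> = "basic_triangle_function X d u v"
  have fin: "?\<Phi> \<noteq> \<infinity>"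
    using normal assms(2,3) unfolding normal_semimetric_def by blast
  show "0 < enn2real ?\<Phi> + 1" by (simp add: add_nonneg_pos)
  fix x y z
  assume "x \<in> X" "y \<in> X" "z \<in> X" "d x z \<le> u" "d z y \<le> v"
  from dist_le_basic_triangle_function[OF this]
  have "enn2real (ennreal (d x y)) \<le> enn2real ?\<Phi>"
    using fin by (intro enn2real_mono) (auto simp: top.not_eq_extremum)
  with \<open>x \<in> X\<close> \<open>y \<in> X\<close> show "d x y \<le> enn2real ?\<Phi> + 1"
    by (simp add: d_nonneg)
qed

lemma finite_bound:
  fixes g :: "'b \<Rightarrow> real"
  assumes "finite F"
  obtains M where "0 < M" "\<And>y. y \<in> F \<Longrightarrow> g y \<le> M"
proof
  show "0 < Max (insert 1 (g ` F))"
    using assms by (intro less_le_trans[OF zero_less_one Max_ge]) auto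
  show "g y \<le> Max (insert 1 (g ` F))" if "y \<in> F" for y
    using assms that by (intro Max_ge) auto
qed

text \<open>Normality is needed here: a finite cover by unit balls bounds the distances to
  finitely many centres, and the triangle function transfers this bound to \<open>K\<close>.\<close>

lemma compactin_bounded:
  assumes normal: "normal_semimetric X d" and K: "compactin \<tau> K" and x: "x \<in> X"
  obtains r where "0 < r" "\<And>y. y \<in> K \<Longrightarrow> d x y \<le> r"
proof -
  have KX: "K \<subseteq> X" using compactin_subset_topspace[OF K] by simp
  have "\<forall>y\<in>K. \<exists>U. openin \<tau> U \<and> y \<in> U \<and> (\<forall>z\<in>U. z \<in> X \<and> d y z < 1)"
  proof
    fix y assume "y \<in> K"
    then have "y \<in> X" using KX by blast
    from ball_neighbourhood[OF this zero_less_one]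
    show "\<exists>U. openin \<tau> U \<and> y \<in> U \<and> (\<forall>z\<in>U. z \<in> X \<and> d y z < 1)" by metis
  qed
  then obtain U where U: "\<And>y. y \<in> K \<Longrightarrow> openin \<tau> (U y)" "\<And>y. y \<in> K \<Longrightarrow> y \<in> U y"
    "\<And>y z. \<lbrakk>y \<in> K; z \<in> U y\<rbrakk> \<Longrightarrow> z \<in> X \<and> d y z < 1"
    by metis
  have "\<exists>\<F>. finite \<F> \<and> \<F> \<subseteq> U ` K \<and> K \<subseteq> \<Union>\<F>"
    using U by (intro compactinD[OF K]) auto
  then obtain F where F: "F \<subseteq> K" "finite F" "K \<subseteq> \<Union>(U ` F)"
    by (metis finite_subset_image)
  obtain M where M: "0 < M" "\<And>y. y \<in> F \<Longrightarrow> d x y \<le> M"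
    using finite_bound[OF F(2), of "d x"] by blast
  obtain c where c: "0 < c"
    "\<And>a b z. \<lbrakk>a \<in> X; b \<in> X; z \<in> X; d a z \<le> M; d z b \<le> 1\<rbrakk> \<Longrightarrow> d a b \<le> c"
    using normal_bound[OF normal, of M 1] M(1) by auto
  show thesis
  proof (rule that[OF c(1)])
    fix y assume "y \<in> K"
    with F(3) obtain a where a: "a \<in> F" "y \<in> U a" by blast
    then have "a \<in> K" using F(1) by blast
    then show "d x y \<le> c"
      using c(2)[of x y a] x U(3)[of a y] a M(2)[of a] KX by auto
  qed
qed

end

section \<open>Comparison functions\<close>

lemma comparison_function_funpow_nonneg:
  assumes "comparison_function \<phi>" "0 \<le> t"
  shows "0 \<le> (\<phi> ^^ n) t"
  using assms by (induction n) (auto simp: comparison_function_def Pi_iff)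

lemma comparison_function_mono:
  assumes "comparison_function \<phi>" "0 \<le> s" "s \<le> t"
  shows "\<phi> s \<le> \<phi> t"
  using assms unfolding comparison_function_def mono_on_def by simp

lemma comparison_function_less:
  assumes \<phi>: "comparison_function \<phi>" and t: "0 < t"
  shows "\<phi> t < t"
proof (rule ccontr)
  assume "\<not> \<phi> t < t"
  then have "t \<le> \<phi> t" by simp
  have "t \<le> (\<phi> ^^ n) t" for n
  proof (induction n)
    case (Suc n)
    then have "\<phi> t \<le> \<phi> ((\<phi> ^^ n) t)"
      using t by (intro comparison_function_mono[OF \<phi>]) auto
    with \<open>t \<le> \<phi> t\<close> show ?case by simp
  qed simp
  moreover have "(\<lambda>n. (\<phi> ^^ n) t) \<longlonglongrightarrow> 0"
    using \<phi> t by (simp add: comparison_function_def)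
  ultimately have "t \<le> 0" by (intro LIMSEQ_le_const[of _ 0]) auto
  with t show False by simp
qed

lemma comparison_function_le:
  assumes \<phi>: "comparison_function \<phi>" and t: "0 \<le> t"
  shows "\<phi> t \<le> t"
proof (cases "t = 0")
  case True
  have "\<phi> 0 \<le> s" if "0 < s" for s
    using comparison_function_mono[OF \<phi>, of 0 s] comparison_function_less[OF \<phi> that] that
    by simp
  then have "\<phi> 0 \<le> 0" by (meson dense_ge)
  then show ?thesis using True by simp
qed (use comparison_function_less[OF \<phi>, of t] t in simp)

lemma comparison_function_funpow_le:
  assumes "comparison_function \<phi>" "0 \<le> t"
  shows "(\<phi> ^^ n) t \<le> t"
proof (induction n)
  case (Suc n)
  have "\<phi> ((\<phi> ^^ n) t) \<le> (\<phi> ^^ n) t"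
    using assms comparison_function_funpow_nonneg comparison_function_le by blast
  with Suc show ?case by simp
qed simp

text \<open>The iterates of the maximum decrease to some \<open>l \<ge> 0\<close>. Suppose \<open>l > 0\<close>. Each of the functions
  is at most \<open>l\<close> somewhere to the right of \<open>l\<close>, as otherwise its own iterates would stay above
  \<open>l\<close>. By monotonicity and finiteness, all are at most \<open>l\<close> on one right neighbourhood of \<open>l\<close>,
  so the iterates of the maximum cannot stay above \<open>l\<close>.\<close>

lemma comparison_function_Max:
  assumes fin: "finite I" and ne: "I \<noteq> {}"
    and cf: "\<And>e. e \<in> I \<Longrightarrow> comparison_function (\<phi> e)"
  shows "comparison_function (\<lambda>t. MAX e\<in>I. \<phi> e t)" (is "comparison_function ?\<psi>")
  unfolding comparison_function_def
proof (intro conjI allI impI)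
  have less_iff: "?\<psi> t < s \<longleftrightarrow> (\<forall>e\<in>I. \<phi> e t < s)" for t s
    using fin ne by (subst Max_less_iff) auto
  have le_iff: "?\<psi> t \<le> s \<longleftrightarrow> (\<forall>e\<in>I. \<phi> e t \<le> s)" for t s
    using fin ne by (subst Max_le_iff) auto
  have ge: "\<phi> e t \<le> ?\<psi> t" if "e \<in> I" for e t
    using fin that by simp
  have nonneg: "0 \<le> ?\<psi> t" if "0 \<le> t" for t
  proof -
    obtain e where e: "e \<in> I" using ne by blast
    then have "0 \<le> \<phi> e t" using cf[of e] that by (auto simp: comparison_function_def)
    with ge[OF e, of t] show ?thesis by linarith
  qed
  then show "?\<psi> \<in> {0..} \<rightarrow> {0..}" by auto
  have mono: "?\<psi> s \<le> ?\<psi> t" if "0 \<le> s" "s \<le> t" for s t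
  proof -
    have "\<phi> e s \<le> ?\<psi> t" if "e \<in> I" for e
      using comparison_function_mono[OF cf[OF that] \<open>0 \<le> s\<close> \<open>s \<le> t\<close>] ge[OF that] by (rule order_trans)
    then show ?thesis using fin ne by simp
  qed
  then show "mono_on {0..} ?\<psi>" by (auto intro!: mono_onI)
  have below: "?\<psi> t < t" if "0 < t" for t
    using cf comparison_function_less that by (simp add: less_iff)
  fix t :: real assume t: "0 < t"
  define a where "a n = (?\<psi> ^^ n) t" for n
  have a_Suc: "a (Suc n) = ?\<psi> (a n)" for n by (simp add: a_def)
  have a0: "0 \<le> a n" for n
    by (induction n) (use t nonneg in \<open>auto simp: a_def\<close>)
  have "?\<psi> 0 \<le> s" if "0 < s" for s
    using mono[of 0 s] below[OF that] that by linarith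
  then have "?\<psi> 0 \<le> 0" by (rule dense_ge)
  then have "a (Suc n) \<le> a n" for n
    using below[of "a n"] a0[of n] unfolding a_Suc by (cases "a n = 0") auto
  then have dec: "decseq a" by (rule decseq_SucI)
  then obtain l where l: "a \<longlonglongrightarrow> l" "\<And>n. l \<le> a n"
    using decseq_convergent[of a 0] a0 by blast
  have "0 \<le> l" using l(1) a0 by (intro LIMSEQ_le_const) auto
  moreover have False if "0 < l"
  proof -
    have "a n \<noteq> l" for n
      using below[OF that] l(2)[of "Suc n"] a_Suc[of n] by auto
    then have above: "l < a n" for n
      using l(2)[of n] by (simp add: order_less_le not_sym)
    then have right: "filterlim a (at_right l) sequentially"
      using l(1) by (auto simp: filterlim_at less_imp_neq[THEN not_sym])
    have "\<forall>\<^sub>F s in at_right l. \<phi> e s \<le> l" if e: "e \<in> I" for e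
    proof -
      have "\<exists>u>l. \<phi> e u \<le> l"
      proof (rule ccontr)
        assume "\<not> ?thesis"
        then have up: "l < \<phi> e u" if "l < u" for u using that by (meson not_le)
        have "l < (\<phi> e ^^ n) (l + 1)" for n by (induction n) (auto intro: up)
        moreover have "(\<lambda>n. (\<phi> e ^^ n) (l + 1)) \<longlonglongrightarrow> 0"
          using cf[OF e] \<open>0 < l\<close> by (simp add: comparison_function_def)
        ultimately have "l \<le> 0" by (intro LIMSEQ_le_const[of _ 0]) (auto intro: less_imp_le)
        with \<open>0 < l\<close> show False by simp
      qed
      then obtain u where u: "l < u" "\<phi> e u \<le> l" by blast
      have "\<phi> e s \<le> l" if "l < s" "s < u" for s
        using comparison_function_mono[OF cf[OF e], of s u] \<open>0 < l\<close> u(2) that by simp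
      with u(1) show ?thesis by (auto simp: eventually_at_right_field)
    qed
    then have "\<forall>\<^sub>F s in at_right l. \<forall>e\<in>I. \<phi> e s \<le> l"
      using fin by (simp add: eventually_ball_finite)
    then have "\<forall>\<^sub>F s in at_right l. ?\<psi> s \<le> l"
      unfolding le_iff .
    then have "\<forall>\<^sub>F n in sequentially. ?\<psi> (a n) \<le> l"
      using right by (rule eventually_compose_filterlim)
    then obtain n where "a (Suc n) \<le> l"
      unfolding a_Suc by (auto dest: eventually_happens)
    with above[of "Suc n"] show False by simp
  qed
  ultimately have "l = 0" by force
  with l(1) show "(\<lambda>n. (?\<psi> ^^ n) t) \<longlonglongrightarrow> 0" by (simp add: a_def[abs_def])
qed

section \<open>Iterates of the graph operator\<close>

text \<open>Every point of the tuple \<open>A\<close> is within \<open>r\<close> of some point of \<open>B\<close> in the same component;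
  this is one half of a Hausdorff distance estimate.\<close>

definition tuple_near ::
  "('a \<Rightarrow> 'a \<Rightarrow> real) \<Rightarrow> nat \<Rightarrow> real \<Rightarrow> (nat \<Rightarrow> 'a set) \<Rightarrow> (nat \<Rightarrow> 'a set) \<Rightarrow> bool" where
  "tuple_near d q r A B \<longleftrightarrow> (\<forall>i\<in>{1..q}. \<forall>a\<in>A i. \<exists>b\<in>B i. d a b \<le> r)"

lemma tuple_near_mono: "tuple_near d q r A B \<Longrightarrow> r \<le> s \<Longrightarrow> tuple_near d q s A B"
  unfolding tuple_near_def by (meson order_trans)

text \<open>A finite directed graph on \<open>{1..q}\<close> whose edge maps all contract with one common comparison
  function \<open>\<psi>\<close>. Vertices without outgoing edges are allowed.\<close>

locale contracting_graph = regular_semimetric_space X d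
  for X :: "'a set" and d :: "'a \<Rightarrow> 'a \<Rightarrow> real" +
  fixes q :: nat and E :: "nat \<Rightarrow> nat \<Rightarrow> 'e set" and f :: "'e \<Rightarrow> 'a \<Rightarrow> 'a"
    and \<psi> :: "real \<Rightarrow> real"
  assumes finite_edges: "\<And>i j. i \<in> {1..q} \<Longrightarrow> j \<in> {1..q} \<Longrightarrow> finite (E i j)"
    and comparison: "comparison_function \<psi>"
    and contraction:
      "\<And>i j e. i \<in> {1..q} \<Longrightarrow> j \<in> {1..q} \<Longrightarrow> e \<in> E i j \<Longrightarrow> phi_contraction X d \<psi> (f e)"
begin

abbreviation T :: "(nat \<Rightarrow> 'a set) \<Rightarrow> nat \<Rightarrow> 'a set" where
  "T \<equiv> graph_operator q E f"

lemma edge_map: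
  assumes "i \<in> {1..q}" "j \<in> {1..q}" "e \<in> E i j" "x \<in> X"
  shows "f e x \<in> X"
  using contraction[OF assms(1-3)] assms(4) by (auto simp: phi_contraction_def)

lemma edge_dist:
  assumes "i \<in> {1..q}" "j \<in> {1..q}" "e \<in> E i j" "x \<in> X" "y \<in> X"
  shows "d (f e x) (f e y) \<le> \<psi> (d x y)"
  using contraction[OF assms(1-3)] assms(4,5) by (auto simp: phi_contraction_def)

lemma edge_continuous:
  assumes e: "i \<in> {1..q}" "j \<in> {1..q}" "e \<in> E i j"
  shows "continuous_map \<tau> \<tau> (f e)"
  unfolding continuous_map_def topspace_semimetric_topology
proof (intro conjI allI impI)
  show "f e \<in> X \<rightarrow> X" using edge_map[OF e] by blast
  fix U assume U: "openin \<tau> U"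
  show "openin \<tau> {x \<in> X. f e x \<in> U}"
    unfolding openin_semimetric_topology
  proof (intro conjI ballI)
    fix x assume x: "x \<in> {x \<in> X. f e x \<in> U}"
    with U obtain r where r: "0 < r" "semimetric_ball X d (f e x) r \<subseteq> U"
      by (auto simp: openin_semimetric_topology)
    have "f e y \<in> U" if "y \<in> X" "d x y < r" for y
    proof -
      have "d (f e x) (f e y) \<le> d x y"
        using edge_dist[OF e, of x y] comparison_function_le[OF comparison, of "d x y"]
          d_nonneg[of x y] x that by auto
      then show ?thesis
        using r(2) that edge_map[OF e] by (auto simp: semimetric_ball_def)
    qed
    with r(1) show "\<exists>r>0. semimetric_ball X d x r \<subseteq> {x \<in> X. f e x \<in> U}"
      by (auto simp: semimetric_ball_def)
  qed auto
qed

lemma in_graph_operator: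
  "i \<in> {1..q} \<Longrightarrow> y \<in> T A i \<longleftrightarrow> (\<exists>j\<in>{1..q}. \<exists>e\<in>E i j. \<exists>x\<in>A j. y = f e x)"
  unfolding graph_operator_def by auto

lemma funpow_subset:
  assumes "\<And>i. i \<in> {1..q} \<Longrightarrow> A i \<subseteq> X" "i \<in> {1..q}"
  shows "(T ^^ n) A i \<subseteq> X"
  using assms(2)
proof (induction n arbitrary: i)
  case (Suc n)
  show ?case
  proof
    fix y assume "y \<in> (T ^^ Suc n) A i"
    then obtain j e x where "j \<in> {1..q}" "e \<in> E i j" "x \<in> (T ^^ n) A j" "y = f e x"
      using Suc.prems by (auto simp: in_graph_operator simp del: atLeastAtMost_iff)
    with Suc show "y \<in> X" using edge_map by blast
  qed
qed (use assms(1) in auto)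

lemma funpow_finite:
  assumes "\<And>i. i \<in> {1..q} \<Longrightarrow> finite (A i)" "i \<in> {1..q}"
  shows "finite ((T ^^ n) A i)"
  using assms(2)
proof (induction n arbitrary: i)
  case (Suc n)
  then show ?case
    using finite_edges by (simp add: graph_operator_def del: atLeastAtMost_iff)
qed (use assms(1) in auto)

lemma near_graph_operator:
  assumes A: "\<And>i. i \<in> {1..q} \<Longrightarrow> A i \<subseteq> X" and B: "\<And>i. i \<in> {1..q} \<Longrightarrow> B i \<subseteq> X"
    and near: "tuple_near d q r A B"
  shows "tuple_near d q (\<psi> r) (T A) (T B)"
  unfolding tuple_near_def
proof (intro ballI)
  fix i y assume i: "i \<in> {1..q}" and "y \<in> T A i"
  then obtain j e x where x: "j \<in> {1..q}" "e \<in> E i j" "x \<in> A j" "y = f e x"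
    by (auto simp: in_graph_operator simp del: atLeastAtMost_iff)
  with near obtain b where b: "b \<in> B j" "d x b \<le> r"
    unfolding tuple_near_def by blast
  have X: "x \<in> X" "b \<in> X" using x b A B by blast+
  have "d y (f e b) \<le> \<psi> (d x b)"
    using edge_dist[OF i x(1,2)] X x(4) by simp
  also have "\<dots> \<le> \<psi> r"
    using b(2) X by (intro comparison_function_mono[OF comparison] d_nonneg)
  finally show "\<exists>b\<in>T B i. d y b \<le> \<psi> r"
    using x(1,2) b(1) in_graph_operator[OF i, of "f e b" B] by blast
qed

lemma near_funpow:
  assumes A: "\<And>i. i \<in> {1..q} \<Longrightarrow> A i \<subseteq> X" and B: "\<And>i. i \<in> {1..q} \<Longrightarrow> B i \<subseteq> X"
    and near: "tuple_near d q r A B"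
  shows "tuple_near d q ((\<psi> ^^ n) r) ((T ^^ n) A) ((T ^^ n) B)"
proof (induction n)
  case (Suc n)
  then show ?case
    using near_graph_operator[OF funpow_subset[OF A] funpow_subset[OF B], where r = "(\<psi> ^^ n) r"]
    by simp
qed (use near in simp)

lemma near_trans:
  assumes A: "\<And>i. i \<in> {1..q} \<Longrightarrow> A i \<subseteq> X" and B: "\<And>i. i \<in> {1..q} \<Longrightarrow> B i \<subseteq> X"
    and C: "\<And>i. i \<in> {1..q} \<Longrightarrow> C i \<subseteq> X"
    and near: "tuple_near d q \<delta> A B" "tuple_near d q \<delta> B C"
    and \<delta>: "\<And>x y z. \<lbrakk>x \<in> X; y \<in> X; z \<in> X; d x z \<le> \<delta>; d z y \<le> \<delta>\<rbrakk> \<Longrightarrow> d x y < \<epsilon>"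
  shows "tuple_near d q \<epsilon> A C"
  unfolding tuple_near_def
proof (intro ballI)
  fix i a assume i: "i \<in> {1..q}" and a: "a \<in> A i"
  from i a near(1) obtain b where b: "b \<in> B i" "d a b \<le> \<delta>"
    unfolding tuple_near_def by blast
  from i b near(2) obtain c where c: "c \<in> C i" "d b c \<le> \<delta>"
    unfolding tuple_near_def by blast
  have "d a c < \<epsilon>"
    using i a b c A B C by (intro \<delta>[of a c b]) blast+
  with c(1) show "\<exists>c\<in>C i. d a c \<le> \<epsilon>" by force
qed

text \<open>With \<open>\<Phi>\<close> the basic triangle function, take \<open>\<delta>\<close> and \<open>\<eta>\<close> with \<open>\<Phi>(\<delta>, \<delta>) < \<epsilon>\<close> and
  \<open>\<Phi>(\<eta>, \<eta>) < \<delta>\<close>, then \<open>N\<close> with \<open>\<psi>\<^sup>N(\<delta>) \<le> \<eta>\<close>, and \<open>n\<close> such that the first \<open>N\<close> iterates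
  after \<open>T\<^sup>n(A)\<close> are close to \<open>T\<^sup>n(A)\<close>. Then \<open>T\<^sup>N\<close> preserves the property of being in the
  \<open>\<delta>\<close>-neighbourhood of \<open>T\<^sup>n(A)\<close>, so this neighbourhood contains
  every \<open>N\<close>-th iterate, and the remaining iterates are reached with one more use of the
  triangle function.\<close>

lemma orbit_near:
  assumes z: "\<And>i. i \<in> {1..q} \<Longrightarrow> z i \<in> X" and A_def: "A = (\<lambda>i\<in>{1..q}. {z i})"
    and \<epsilon>: "0 < \<epsilon>"
  obtains n where "\<And>m. n \<le> m \<Longrightarrow> tuple_near d q \<epsilon> ((T ^^ m) A) ((T ^^ n) A)"
proof -
  have A: "A i \<subseteq> X" "finite (A i)" if "i \<in> {1..q}" for i
    using z[OF that] that by (auto simp: A_def)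
  have TX: "(T ^^ m) A i \<subseteq> X" if "i \<in> {1..q}" for m i
    using funpow_subset[of A, OF A(1) that] .
  obtain \<delta> where \<delta>: "0 < \<delta>"
    "\<And>a b c. \<lbrakk>a \<in> X; b \<in> X; c \<in> X; d a c \<le> \<delta>; d c b \<le> \<delta>\<rbrakk> \<Longrightarrow> d a b < \<epsilon>"
    using weak_triangle[OF \<epsilon>] by blast
  obtain \<eta> where \<eta>: "0 < \<eta>"
    "\<And>a b c. \<lbrakk>a \<in> X; b \<in> X; c \<in> X; d a c \<le> \<eta>; d c b \<le> \<eta>\<rbrakk> \<Longrightarrow> d a b < \<delta>"
    using weak_triangle[OF \<delta>(1)] by blast
  have to_0: "(\<lambda>n. (\<psi> ^^ n) t) \<longlonglongrightarrow> 0" if "0 < t" for t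
    using comparison that by (simp add: comparison_function_def)
  have "\<forall>\<^sub>F N in sequentially. (\<psi> ^^ N) \<delta> < \<eta> \<and> 0 < N"
    using order_tendstoD(2)[OF to_0[OF \<delta>(1)] \<eta>(1)] eventually_gt_at_top
    by (rule eventually_conj)
  then obtain N where N: "(\<psi> ^^ N) \<delta> < \<eta>" "0 < N" by (auto dest: eventually_happens)
  have "finite (\<Union>j\<in>{..N}. \<Union>i\<in>{1..q}. (\<lambda>a. d a (z i)) ` (T ^^ j) A i)"
    using funpow_finite[OF A(2)] by (auto simp del: atLeastAtMost_iff)
  then obtain c where c: "0 < c"
    "\<And>t. t \<in> (\<Union>j\<in>{..N}. \<Union>i\<in>{1..q}. (\<lambda>a. d a (z i)) ` (T ^^ j) A i) \<Longrightarrow> t \<le> c"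
    using finite_bound[where g = "\<lambda>t. t"] by blast
  have near_start: "tuple_near d q c ((T ^^ j) A) A" if "j \<le> N" for j
    unfolding tuple_near_def
  proof (intro ballI)
    fix i a assume i: "i \<in> {1..q}" and a: "a \<in> (T ^^ j) A i"
    have "d a (z i) \<le> c"
      using that i a by (intro c(2)) blast
    then show "\<exists>b\<in>A i. d a b \<le> c"
      using i by (simp add: A_def)
  qed
  have "\<forall>\<^sub>F n in sequentially. (\<psi> ^^ n) c < min \<delta> \<eta>"
    using order_tendstoD(2)[OF to_0[OF c(1)], of "min \<delta> \<eta>"] \<delta>(1) \<eta>(1) by simp
  then obtain n where n: "(\<psi> ^^ n) c < min \<delta> \<eta>" by (auto dest: eventually_happens)
  have short: "tuple_near d q (min \<delta> \<eta>) ((T ^^ (n + j)) A) ((T ^^ n) A)" if "j \<le> N" for j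
    using near_funpow[OF TX A(1) near_start[OF that], of n] n
    by (auto simp: funpow_add intro: tuple_near_mono)
  have multiples: "tuple_near d q \<delta> ((T ^^ (n + k * N)) A) ((T ^^ n) A)" for k
  proof (induction k)
    case 0
    show ?case
      unfolding tuple_near_def
    proof (intro ballI)
      fix i a assume "i \<in> {1..q}" "a \<in> (T ^^ (n + 0 * N)) A i"
      moreover from this have "d a a \<le> \<delta>"
        using TX[of i "n + 0 * N"] d_self[of a] \<delta>(1) by auto
      ultimately show "\<exists>b\<in>(T ^^ n) A i. d a b \<le> \<delta>" by auto
    qed
  next
    case (Suc k)
    have "tuple_near d q ((\<psi> ^^ N) \<delta>) ((T ^^ N) ((T ^^ (n + k * N)) A)) ((T ^^ N) ((T ^^ n) A))"
      using near_funpow[OF TX TX Suc] .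
    then have "tuple_near d q \<eta> ((T ^^ (n + Suc k * N)) A) ((T ^^ (n + N)) A)"
      using N(1) by (auto simp: funpow_add[symmetric] comp_apply[of "T ^^ _" "T ^^ _", symmetric]
        ac_simps simp del: comp_apply intro: tuple_near_mono)
    moreover have "tuple_near d q \<eta> ((T ^^ (n + N)) A) ((T ^^ n) A)"
      using short[of N] by (rule tuple_near_mono) auto
    ultimately show ?case
      by (rule near_trans[rotated 3]) (rule TX \<eta>(2); assumption)+
  qed
  show thesis
  proof (rule that)
    fix m assume "n \<le> m"
    define k j where "k = (m - n) div N" and "j = (m - n) mod N"
    have j: "j \<le> N" using N(2) by (simp add: j_def less_imp_le)
    have m: "m = j + (n + k * N)"
      using \<open>n \<le> m\<close> by (simp add: k_def j_def)
    have "tuple_near d q ((\<psi> ^^ j) \<delta>) ((T ^^ j) ((T ^^ (n + k * N)) A)) ((T ^^ j) ((T ^^ n) A))"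
      using near_funpow[OF TX TX multiples] .
    moreover have "(\<psi> ^^ j) \<delta> \<le> \<delta>"
      using comparison_function_funpow_le[OF comparison] \<delta>(1) by simp
    moreover have "(T ^^ j) ((T ^^ (n + k * N)) A) = (T ^^ m) A" "(T ^^ j) ((T ^^ n) A) = (T ^^ (n + j)) A"
      unfolding m by (simp_all add: funpow_add add.commute[of n j])
    ultimately have "tuple_near d q \<delta> ((T ^^ m) A) ((T ^^ (n + j)) A)"
      using tuple_near_mono by metis
    moreover have "tuple_near d q \<delta> ((T ^^ (n + j)) A) ((T ^^ n) A)"
      using short[OF j] by (rule tuple_near_mono) auto
    ultimately show "tuple_near d q \<epsilon> ((T ^^ m) A) ((T ^^ n) A)"
      by (rule near_trans[rotated 3]) (rule TX \<delta>(2); assumption)+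
  qed
qed

section \<open>Invariant tuples\<close>

text \<open>With \<open>\<sigma> i\<close> the chosen successor of \<open>i\<close> and \<open>g i\<close> the chosen edge, the points \<open>z i\<close> are
  the limits of the orbit under the operator of the subgraph that has only the edges \<open>g i\<close>.\<close>

lemma selected_edges_fixed_point:
  assumes complete: "semimetric_complete X d"
    and \<sigma>: "\<And>i. i \<in> {1..q} \<Longrightarrow> \<sigma> i \<in> {1..q}"
    and g: "\<And>i. i \<in> {1..q} \<Longrightarrow> g i \<in> E i (\<sigma> i)"
  obtains z where "\<And>i. i \<in> {1..q} \<Longrightarrow> z i \<in> X" "\<And>i. i \<in> {1..q} \<Longrightarrow> z i = f (g i) (z (\<sigma> i))"
proof -
  define E' where "E' i j = (if j = \<sigma> i then {g i} else {})" for i j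
  interpret sub: contracting_graph X d q E' f \<psi>
  proof
    fix i j e assume "i \<in> {1..q}" "j \<in> {1..q}" "e \<in> E' i j"
    then show "phi_contraction X d \<psi> (f e)"
      using contraction g by (auto simp: E'_def simp del: atLeastAtMost_iff split: if_splits)
  qed (auto simp: E'_def comparison)
  obtain p where p: "p \<in> X"
    using semimetric by (auto simp: semimetric_space_def)
  define w where "w n = ((\<lambda>v i. f (g i) (v (\<sigma> i))) ^^ n) (\<lambda>_. p)" for n
  have w_0: "w 0 i = p" and w_Suc: "w (Suc n) i = f (g i) (w n (\<sigma> i))" for n i
    by (simp_all add: w_def)
  define A where "A = (\<lambda>i\<in>{1..q}. {w 0 i})"
  have wX: "w n i \<in> X" if "i \<in> {1..q}" for n i
    using that
  proof (induction n arbitrary: i)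
    case (Suc n)
    then show ?case using edge_map[of i "\<sigma> i" "g i"] \<sigma> g by (simp add: w_Suc del: atLeastAtMost_iff)
  qed (simp add: w_0 p)
  have orbit: "(sub.T ^^ n) A = (\<lambda>i\<in>{1..q}. {w n i})" for n
  proof (induction n)
    case (Suc n)
    have "sub.T (\<lambda>i\<in>{1..q}. {w n i}) i = {w (Suc n) i}" if "i \<in> {1..q}" for i
      using that \<sigma>[OF that] by (auto simp: graph_operator_def E'_def w_Suc split: if_splits)
    then have "sub.T (\<lambda>i\<in>{1..q}. {w n i}) = (\<lambda>i\<in>{1..q}. {w (Suc n) i})"
      by (intro extensionalityI[of _ "{1..q}"]) (auto simp: graph_operator_def)
    then show ?case unfolding funpow.simps comp_apply Suc .
  qed (simp add: A_def)
  have "\<exists>x\<in>X. (\<lambda>n. d (w n i) x) \<longlonglongrightarrow> 0" if i: "i \<in> {1..q}" for i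
  proof -
    have "semimetric_Cauchy d (\<lambda>n. w n i)"
    proof (rule Cauchy_if_eventually_near)
      fix \<epsilon> :: real assume \<epsilon>: "0 < \<epsilon>"
      obtain n where n: "\<And>m. n \<le> m \<Longrightarrow> tuple_near d q \<epsilon> ((sub.T ^^ m) A) ((sub.T ^^ n) A)"
        using sub.orbit_near[OF wX A_def \<epsilon>] by blast
      have "d (w m i) (w n i) \<le> \<epsilon>" if "n \<le> m" for m
        using n[OF that] i by (simp add: orbit tuple_near_def)
      then show "\<exists>c\<in>X. \<exists>n. \<forall>m\<ge>n. d (w m i) c \<le> \<epsilon>"
        using wX[OF i] by blast
    qed (use wX[OF i] in blast)
    moreover have "range (\<lambda>n. w n i) \<subseteq> X" using wX[OF i] by blast
    ultimately have "semimetric_convergent X d (\<lambda>n. w n i)"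
      using complete unfolding semimetric_complete_def by simp
    then show ?thesis unfolding semimetric_convergent_def .
  qed
  then obtain z where z: "\<And>i. i \<in> {1..q} \<Longrightarrow> z i \<in> X"
    "\<And>i. i \<in> {1..q} \<Longrightarrow> (\<lambda>n. d (w n i) (z i)) \<longlonglongrightarrow> 0"
    by metis
  show thesis
  proof (rule that)
    fix i assume i: "i \<in> {1..q}"
    show "z i \<in> X" using z(1)[OF i] .
    have X: "f (g i) (z (\<sigma> i)) \<in> X"
      using edge_map[OF i \<sigma>[OF i] g[OF i]] z(1) \<sigma>[OF i] by blast
    have le: "d (w (Suc n) i) (f (g i) (z (\<sigma> i))) \<le> d (w n (\<sigma> i)) (z (\<sigma> i))" for n
    proof -
      have "d (w (Suc n) i) (f (g i) (z (\<sigma> i))) \<le> \<psi> (d (w n (\<sigma> i)) (z (\<sigma> i)))"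
        unfolding w_Suc using edge_dist[OF i \<sigma>[OF i] g[OF i]] wX z(1) \<sigma>[OF i] by blast
      also have "\<dots> \<le> d (w n (\<sigma> i)) (z (\<sigma> i))"
        using wX z(1) \<sigma>[OF i] by (intro comparison_function_le[OF comparison] d_nonneg)
      finally show ?thesis .
    qed
    have "(\<lambda>n. d (w (Suc n) i) (f (g i) (z (\<sigma> i)))) \<longlonglongrightarrow> 0"
    proof (rule tendsto_sandwich[OF _ _ tendsto_const z(2)[OF \<sigma>[OF i]]])
      show "\<forall>\<^sub>F n in sequentially. 0 \<le> d (w (Suc n) i) (f (g i) (z (\<sigma> i)))"
        using d_nonneg[OF wX[OF i] X] by simp
    qed (use le in simp)
    moreover have "(\<lambda>n. d (w (Suc n) i) (z i)) \<longlonglongrightarrow> 0"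
      using z(2)[OF i] by (rule LIMSEQ_Suc)
    ultimately show "z i = f (g i) (z (\<sigma> i))"
      using limit_unique[of "z i" "f (g i) (z (\<sigma> i))" "\<lambda>n. w (Suc n) i"] z(1)[OF i] X wX[OF i]
      by blast
  qed
qed

text \<open>The hypothesis that \<open>A\<close> is subinvariant yields the inclusion of \<open>H\<close> in \<open>T(H)\<close>: a point of
  the union that lies in \<open>T\<^sup>0(A)\<close> lies in \<open>T(A)\<close> as well.\<close>

lemma compact_invariant_closure:
  assumes complete: "semimetric_complete X d"
    and z: "\<And>i. i \<in> {1..q} \<Longrightarrow> z i \<in> X" and A_def: "A = (\<lambda>i\<in>{1..q}. {z i})"
    and sub: "subinvariant q T A"
  defines "H \<equiv> tuple_closure X d q (tuple_Union q (\<lambda>n. (T ^^ n) A))"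
  shows "H \<in> {1..q} \<rightarrow>\<^sub>E nonempty_compacts X d" and "invariant T H"
proof -
  define S where "S i = (\<Union>n. (T ^^ n) A i)" for i
  have A: "A i \<subseteq> X" "finite (A i)" if "i \<in> {1..q}" for i
    using z[OF that] that by (auto simp: A_def)
  have SX: "S i \<subseteq> X" if "i \<in> {1..q}" for i
    unfolding S_def using funpow_subset[of A, OF A(1) that] by blast
  have H: "H i = \<tau> closure_of S i" if "i \<in> {1..q}" for i
    using that by (simp add: H_def tuple_closure_def tuple_Union_def S_def)
  have S_H: "S i \<subseteq> H i" if "i \<in> {1..q}" for i
    using closure_of_subset[of "S i" \<tau>] SX[OF that] H[OF that] by simp
  have compact: "compactin \<tau> (H i)" if i: "i \<in> {1..q}" for i
    unfolding H[OF i]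
  proof (rule compactin_closure_of_totally_bounded[OF complete SX[OF i]])
    fix \<epsilon> :: real assume \<epsilon>: "0 < \<epsilon>"
    obtain n where n: "\<And>m. n \<le> m \<Longrightarrow> tuple_near d q \<epsilon> ((T ^^ m) A) ((T ^^ n) A)"
      using orbit_near[OF z A_def \<epsilon>] by blast
    \<comment> \<open>Including the iterates before \<open>n\<close> in the net avoids an appeal to monotonicity of \<open>T\<close>.\<close>
    let ?F = "\<Union>m\<in>{..n}. (T ^^ m) A i"
    have "\<exists>c\<in>?F. d a c \<le> \<epsilon>" if a: "a \<in> S i" for a
    proof -
      obtain m where m: "a \<in> (T ^^ m) A i" using a by (auto simp: S_def)
      show ?thesis
      proof (cases "n \<le> m")
        case True
        then obtain c where "c \<in> (T ^^ n) A i" "d a c \<le> \<epsilon>"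
          using n[OF True] i m unfolding tuple_near_def by blast
        then show ?thesis by blast
      next
        case False
        then have "a \<in> ?F" using m by force
        moreover have "d a a \<le> \<epsilon>" using a SX[OF i] d_self[of a] \<epsilon> by auto
        ultimately show ?thesis by blast
      qed
    qed
    moreover have "finite ?F" using funpow_finite[of A, OF A(2) i] by blast
    moreover have "?F \<subseteq> X" using funpow_subset[of A, OF A(1) i] by blast
    ultimately show "\<exists>F. finite F \<and> F \<subseteq> X \<and> (\<forall>a\<in>S i. \<exists>c\<in>F. d a c \<le> \<epsilon>)" by blast
  qed
  have "H i \<noteq> {}" if "i \<in> {1..q}" for i
  proof -
    have "z i \<in> (T ^^ 0) A i" using that by (simp add: A_def)
    then have "z i \<in> S i" unfolding S_def by blast
    with S_H[OF that] show ?thesis by blast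
  qed
  with compact show "H \<in> {1..q} \<rightarrow>\<^sub>E nonempty_compacts X d"
    by (auto simp: nonempty_compacts_def H_def tuple_closure_def)
  have T_S: "f e ` S j \<subseteq> S i" if "i \<in> {1..q}" "j \<in> {1..q}" "e \<in> E i j" for i j e
  proof
    fix y assume "y \<in> f e ` S j"
    then obtain n x where "x \<in> (T ^^ n) A j" "y = f e x" by (auto simp: S_def)
    then have "y \<in> T ((T ^^ n) A) i" unfolding in_graph_operator[OF that(1)] using that by blast
    then have "y \<in> (T ^^ Suc n) A i" by simp
    then show "y \<in> S i" unfolding S_def by blast
  qed
  have S_T: "S i \<subseteq> T H i" if i: "i \<in> {1..q}" for i
  proof
    fix y assume "y \<in> S i"
    then obtain n where n: "y \<in> (T ^^ n) A i" by (auto simp: S_def)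
    have "\<exists>m. y \<in> T ((T ^^ m) A) i"
    proof (cases n)
      case 0
      then have "y \<in> T ((T ^^ 0) A) i"
        using n sub i by (auto simp: subinvariant_def tuple_subset_def)
      then show ?thesis by blast
    next
      case (Suc m)
      then show ?thesis using n by auto
    qed
    then obtain m j e x where x: "j \<in> {1..q}" "e \<in> E i j" "x \<in> (T ^^ m) A j" "y = f e x"
      unfolding in_graph_operator[OF i] by blast
    then have "x \<in> H j" using S_H[OF x(1)] by (auto simp: S_def)
    with x show "y \<in> T H i" unfolding in_graph_operator[OF i] by blast
  qed
  have "T H i = H i" if i: "i \<in> {1..q}" for i
  proof
    show "T H i \<subseteq> H i"
    proof
      fix y assume "y \<in> T H i"
      then obtain j e x where x: "j \<in> {1..q}" "e \<in> E i j" "x \<in> H j" "y = f e x"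
        unfolding in_graph_operator[OF i] by blast
      have "f e ` H j \<subseteq> \<tau> closure_of (f e ` S j)"
        unfolding H[OF x(1)]
        by (rule continuous_map_image_closure_subset[OF edge_continuous[OF i x(1,2)]])
      also have "\<dots> \<subseteq> H i"
        unfolding H[OF i] by (rule closure_of_mono[OF T_S[OF i x(1,2)]])
      finally show "y \<in> H i" using x(3,4) by blast
    qed
    have "compactin \<tau> (T H i)"
    proof -
      have "compactin \<tau> (\<Union>e\<in>E i j. f e ` H j)" if "j \<in> {1..q}" for j
        using finite_edges[OF i that] image_compactin[OF compact[OF that] edge_continuous[OF i that]]
        by (intro compactin_Union) auto
      then have "compactin \<tau> (\<Union>j\<in>{1..q}. \<Union>e\<in>E i j. f e ` H j)"
        by (intro compactin_Union) auto
      then show ?thesis using i by (simp add: graph_operator_def)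
    qed
    then have "closedin \<tau> (T H i)"
      by (rule compactin_imp_closedin[OF Hausdorff_semimetric_topology])
    then show "H i \<subseteq> T H i"
      unfolding H[OF i] using S_T[OF i] by (rule closure_of_minimal[rotated])
  qed
  then have "H = T H"
    by (intro extensionalityI[of _ "{1..q}"]) (auto simp: H_def tuple_closure_def graph_operator_def)
  then show "invariant T H" unfolding invariant_def .
qed

text \<open>As \<open>H\<close> and \<open>K\<close> are fixed by \<open>T\<^sup>n\<close>, a bound \<open>c\<close> on the distances from \<open>H\<close> to \<open>K\<close> improves
  to \<open>\<psi>\<^sup>n(c)\<close> for every \<open>n\<close>.\<close>

lemma compact_invariant_subset:
  assumes normal: "normal_semimetric X d"
    and H: "H \<in> {1..q} \<rightarrow>\<^sub>E nonempty_compacts X d" "invariant T H"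
    and K: "K \<in> {1..q} \<rightarrow>\<^sub>E nonempty_compacts X d" "invariant T K"
    and i: "i \<in> {1..q}"
  shows "H i \<subseteq> K i"
proof -
  have comp: "compactin \<tau> (H j)" "compactin \<tau> (K j)" and ne: "K j \<noteq> {}" if "j \<in> {1..q}" for j
    using PiE_mem[OF H(1) that] PiE_mem[OF K(1) that] by (auto simp: nonempty_compacts_def)
  have sub: "H j \<subseteq> X" "K j \<subseteq> X" if "j \<in> {1..q}" for j
    using comp[OF that] compactin_subset_topspace by fastforce+
  obtain p where p: "p \<in> X"
    using semimetric by (auto simp: semimetric_space_def)
  have "compactin \<tau> (\<Union>j\<in>{1..q}. H j \<union> K j)"
    using comp by (intro compactin_Union) (auto intro: compactin_Un simp del: atLeastAtMost_iff)
  then obtain r where r: "0 < r" "\<And>y. y \<in> (\<Union>j\<in>{1..q}. H j \<union> K j) \<Longrightarrow> d p y \<le> r"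
    using compactin_bounded[OF normal _ p] by blast
  obtain c where c: "0 < c"
    "\<And>x y z. \<lbrakk>x \<in> X; y \<in> X; z \<in> X; d x z \<le> r; d z y \<le> r\<rbrakk> \<Longrightarrow> d x y \<le> c"
    using normal_bound[OF normal, of r r] r(1) by auto
  have near: "tuple_near d q c H K"
    unfolding tuple_near_def
  proof (intro ballI)
    fix j x assume j: "j \<in> {1..q}" and x: "x \<in> H j"
    obtain y where y: "y \<in> K j" using ne[OF j] by blast
    have X: "x \<in> X" "y \<in> X" using x y sub[OF j] by blast+
    have "d p x \<le> r" "d p y \<le> r" using j x y by (blast intro: r(2))+
    then have "d x p \<le> r" "d p y \<le> r" using d_sym[OF X(1) p] by simp_all
    then have "d x y \<le> c" using c(2) X p by blast
    with y show "\<exists>b\<in>K j. d x b \<le> c" by blast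
  qed
  have fixed: "(T ^^ n) H = H" "(T ^^ n) K = K" for n
    using H(2) K(2) by (induction n) (simp_all add: invariant_def)
  have near_n: "tuple_near d q ((\<psi> ^^ n) c) H K" for n
    using near_funpow[OF sub near, of n] by (simp add: fixed)
  have "H i \<subseteq> \<tau> closure_of K i"
  proof
    fix x assume x: "x \<in> H i"
    show "x \<in> \<tau> closure_of K i"
      unfolding in_closure_of_semimetric[OF sub(2)[OF i]]
    proof (intro conjI allI impI)
      show "x \<in> X" using x sub(1)[OF i] by blast
      fix s :: real assume "0 < s"
      moreover have "(\<lambda>n. (\<psi> ^^ n) c) \<longlonglongrightarrow> 0"
        using comparison c(1) by (simp add: comparison_function_def)
      ultimately have "\<forall>\<^sub>F n in sequentially. (\<psi> ^^ n) c < s" by (rule order_tendstoD(2)[rotated])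
      then obtain n where n: "(\<psi> ^^ n) c < s" by (auto dest: eventually_happens)
      obtain b where "b \<in> K i" "d x b \<le> (\<psi> ^^ n) c"
        using near_n[of n] i x unfolding tuple_near_def by blast
      with n show "\<exists>b\<in>K i. d x b < s" by force
    qed
  qed
  also have "\<tau> closure_of K i = K i"
    using compactin_imp_closedin[OF Hausdorff_semimetric_topology comp(2)[OF i]]
    by (simp add: closure_of_closedin)
  finally show ?thesis .
qed

lemma compact_invariant_unique:
  assumes "normal_semimetric X d"
    and "H \<in> {1..q} \<rightarrow>\<^sub>E nonempty_compacts X d" "invariant T H"
    and "K \<in> {1..q} \<rightarrow>\<^sub>E nonempty_compacts X d" "invariant T K"
  shows "H = K"
  using assms by (intro PiE_ext[of H _ _ K] subset_antisym compact_invariant_subset)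

end

section \<open>The invariant tuple of a graph-directed system\<close>

theorem theorem1p1:
  fixes X :: "'a set" and d :: "'a \<Rightarrow> 'a \<Rightarrow> real"
    and q :: nat and E :: "nat \<Rightarrow> nat \<Rightarrow> 'e set"
    and \<phi> :: "'e \<Rightarrow> real \<Rightarrow> real" and f :: "'e \<Rightarrow> 'a \<Rightarrow> 'a"
    and T :: "(nat \<Rightarrow> 'a set) \<Rightarrow> nat \<Rightarrow> 'a set"
  defines "T \<equiv> graph_operator q E f"
  assumes "semimetric_space X d" and "semimetric_complete X d"
    and "regular_semimetric X d" and "normal_semimetric X d"
    and "1 \<le> q"
    and "\<And>i j. i \<in> {1..q} \<Longrightarrow> j \<in> {1..q} \<Longrightarrow> finite (E i j)"
    and "\<And>i. i \<in> {1..q} \<Longrightarrow> \<exists>j\<in>{1..q}. E i j \<noteq> {}"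
    and "\<And>i j e. i \<in> {1..q} \<Longrightarrow> j \<in> {1..q} \<Longrightarrow> e \<in> E i j \<Longrightarrow>
           comparison_function (\<phi> e) \<and> right_continuous (\<phi> e) \<and> phi_contraction X d (\<phi> e) (f e)"
  shows "(\<exists>!H. H \<in> {1..q} \<rightarrow>\<^sub>E nonempty_compacts X d \<and> invariant T H) \<and>
         (\<forall>H. H \<in> {1..q} \<rightarrow>\<^sub>E nonempty_compacts X d \<and> invariant T H \<longrightarrow>
            (\<exists>H0 \<in> {1..q} \<rightarrow>\<^sub>E nonempty_subsets X.
               (\<exists>z \<in> {1..q} \<rightarrow> X. H0 = (\<lambda>i\<in>{1..q}. {z i})) \<and>
               subinvariant q T H0 \<and>
               H = tuple_closure X d q (tuple_Union q (\<lambda>n. (T ^^ n) H0))))"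
proof -
  note finE = assms(7) and neE = assms(8) and edges = assms(9)
  define I where "I = (\<Union>i\<in>{1..q}. \<Union>j\<in>{1..q}. E i j)"
  have fin: "finite I" unfolding I_def using finE by blast
  have "1 \<in> {1..q}" using \<open>1 \<le> q\<close> by simp
  from neE[OF this] this have ne: "I \<noteq> {}" unfolding I_def by blast
  have I: "comparison_function (\<phi> e)" if "e \<in> I" for e
  proof -
    obtain i j where "i \<in> {1..q}" "j \<in> {1..q}" "e \<in> E i j"
      using \<open>e \<in> I\<close> unfolding I_def by blast
    from edges[OF this] show ?thesis by simp
  qed
  define \<psi> where "\<psi> t = (MAX e\<in>I. \<phi> e t)" for t
  have \<psi>: "comparison_function \<psi>"
    unfolding \<psi>_def[abs_def] using comparison_function_Max[OF fin ne] I by blast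
  interpret contracting_graph X d q E f \<psi>
  proof
    fix i j e assume ij: "i \<in> {1..q}" "j \<in> {1..q}" "e \<in> E i j"
    then have "e \<in> I" unfolding I_def by blast
    then have "\<phi> e t \<le> \<psi> t" for t unfolding \<psi>_def using fin by simp
    with edges[OF ij] show "phi_contraction X d \<psi> (f e)"
      unfolding phi_contraction_def by (meson order_trans)
  qed (use assms(2,4) finE \<psi> in auto)
  have "\<exists>j e. j \<in> {1..q} \<and> e \<in> E i j" if "i \<in> {1..q}" for i
    using neE[OF that] by blast
  then obtain \<sigma> g where \<sigma>: "\<And>i. i \<in> {1..q} \<Longrightarrow> \<sigma> i \<in> {1..q}"
    and g: "\<And>i. i \<in> {1..q} \<Longrightarrow> g i \<in> E i (\<sigma> i)"
    by metis
  obtain z where z: "\<And>i. i \<in> {1..q} \<Longrightarrow> z i \<in> X"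
    and z_eq: "\<And>i. i \<in> {1..q} \<Longrightarrow> z i = f (g i) (z (\<sigma> i))"
    using selected_edges_fixed_point[OF assms(3) \<sigma> g] by blast
  define H0 where "H0 = (\<lambda>i\<in>{1..q}. {z i})"
  have sub: "subinvariant q T H0"
    unfolding subinvariant_def tuple_subset_def T_def
  proof (intro ballI subsetI)
    fix i x assume i: "i \<in> {1..q}" and "x \<in> H0 i"
    then have "x = f (g i) (z (\<sigma> i))" using z_eq[OF i] by (simp add: H0_def)
    moreover have "z (\<sigma> i) \<in> H0 (\<sigma> i)" using \<sigma>[OF i] by (simp add: H0_def)
    ultimately show "x \<in> graph_operator q E f H0 i"
      unfolding in_graph_operator[OF i] using \<sigma>[OF i] g[OF i] by blast
  qed
  define H where "H = tuple_closure X d q (tuple_Union q (\<lambda>n. (T ^^ n) H0))"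
  have H: "H \<in> {1..q} \<rightarrow>\<^sub>E nonempty_compacts X d" "invariant T H"
    using compact_invariant_closure[OF assms(3) z H0_def sub[unfolded T_def]]
    unfolding H_def T_def by blast+
  have unique: "K = H" if "K \<in> {1..q} \<rightarrow>\<^sub>E nonempty_compacts X d" "invariant T K" for K
    using compact_invariant_unique[OF assms(5)] that H unfolding T_def by blast
  have H0: "H0 \<in> {1..q} \<rightarrow>\<^sub>E nonempty_subsets X"
    using z by (auto simp: H0_def nonempty_subsets_def)
  have singletons: "\<exists>z \<in> {1..q} \<rightarrow> X. H0 = (\<lambda>i\<in>{1..q}. {z i})"
  proof
    show "H0 = (\<lambda>i\<in>{1..q}. {z i})" by (rule H0_def)
    show "z \<in> {1..q} \<rightarrow> X" using z by (rule Pi_I)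
  qed
  show ?thesis
  proof (intro conjI allI impI)
    show "\<exists>!H. H \<in> {1..q} \<rightarrow>\<^sub>E nonempty_compacts X d \<and> invariant T H"
    proof (rule ex1I[of _ H])
      show "H \<in> {1..q} \<rightarrow>\<^sub>E nonempty_compacts X d \<and> invariant T H"
        using H by (rule conjI)
    qed (erule conjE, rule unique)
    fix K assume "K \<in> {1..q} \<rightarrow>\<^sub>E nonempty_compacts X d \<and> invariant T K"
    then have K: "K = tuple_closure X d q (tuple_Union q (\<lambda>n. (T ^^ n) H0))"
      unfolding H_def[symmetric] by (elim conjE) (rule unique)
    show "\<exists>H0 \<in> {1..q} \<rightarrow>\<^sub>E nonempty_subsets X.
        (\<exists>z \<in> {1..q} \<rightarrow> X. H0 = (\<lambda>i\<in>{1..q}. {z i})) \<and> subinvariant q T H0 \<and>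
        K = tuple_closure X d q (tuple_Union q (\<lambda>n. (T ^^ n) H0))"
      by (rule bexI[of _ H0], intro conjI) (rule singletons sub K H0)+
  qed
qed

end
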